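(* The ideal $\mathcal L$ on $\omega$ generated by lacunary sets is not $\le_K$-homogeneous (in particular, it is not homogeneous).
   Context: An ideal on a set $X$ is a family of subsets of $X$ closed under finite unions and subsets, containing all finite subsets of $X$ and not containing $X$; $\mathcal I^+=\mathcal P(X)\setminus\mathcal I$. A set $A\subseteq\omega$ is lacunary if $\lim_{n}(a_{n+1}-a_n)=\infty$, where $(a_n)$ is the increasing enumeration of $A$; $\mathcal L$ consists of all subsets of finite unions of lacunary sets (and finite sets). For ideals $\mathcal I$ on $X$ and $\mathcal K$ on $Y$, $\mathcal I\le_K\mathcal K$ (Katětov order) means that there is $f:Y\to X$ with $f^{-1}[B]\in\mathcal K$ for all $B\in\mathcal I$; $\mathcal I$ and $\mathcal K$ are isomorphic if there is a bijection $f:Y\to X$ with $f^{-1}[B]\in\mathcal K\iff B\in\mathcal I$. For $A\in\mathcal I^+$, $\mathcal I\restriction A=\{B\cap A:B\in\mathcal I\}$ (an ideal on $A$). $\mathcal I$ is homogeneous if $\mathcal I\restriction A$ is isomorphic to $\mathcal I$ for each $A\in\mathcal I^+$, and $\le_K$-homogeneous if $\mathcal I\restriction A\le_K\mathcal I$ and $\mathcal I\le_K\mathcal I\restriction A$ for each $A\in\mathcal I^+$. *)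

theory Defs
  imports Complex_Main "HOL-Library.Infinite_Set" "HOL-Library.FuncSet"
begin

text \<open>Ideals live on explicit carrier sets, since a restriction to \<open>A\<close> is an ideal on \<open>A\<close>.\<close>

definition ideal_on :: "'a set \<Rightarrow> 'a set set \<Rightarrow> bool" where
  "ideal_on X I \<longleftrightarrow>
     I \<subseteq> Pow X \<and>
     (\<forall>A\<in>I. \<forall>B\<in>I. A \<union> B \<in> I) \<and>
     (\<forall>A\<in>I. \<forall>B. B \<subseteq> A \<longrightarrow> B \<in> I) \<and>
     (\<forall>A. finite A \<and> A \<subseteq> X \<longrightarrow> A \<in> I) \<and>
     X \<notin> I"

definition restrict_ideal :: "'a set set \<Rightarrow> 'a set \<Rightarrow> 'a set set" where
  "restrict_ideal I A = {B \<inter> A | B. B \<in> I}"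

text \<open>\<open>katetov_le X I Y K\<close> is \<open>I \<le>\<^sub>K K\<close> for \<open>I\<close> on \<open>X\<close> and \<open>K\<close> on \<open>Y\<close>; the witness maps \<open>Y\<close> to \<open>X\<close>.\<close>

definition katetov_le :: "'a set \<Rightarrow> 'a set set \<Rightarrow> 'b set \<Rightarrow> 'b set set \<Rightarrow> bool" where
  "katetov_le X I Y K \<longleftrightarrow> (\<exists>f \<in> Y \<rightarrow> X. \<forall>B\<in>I. f -` B \<inter> Y \<in> K)"

definition isomorphic_ideals :: "'a set \<Rightarrow> 'a set set \<Rightarrow> 'b set \<Rightarrow> 'b set set \<Rightarrow> bool" where
  "isomorphic_ideals X I Y K \<longleftrightarrow>
     (\<exists>f. bij_betw f Y X \<and> (\<forall>B. B \<subseteq> X \<longrightarrow> (f -` B \<inter> Y \<in> K \<longleftrightarrow> B \<in> I)))"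

definition homogeneous_ideal :: "'a set \<Rightarrow> 'a set set \<Rightarrow> bool" where
  "homogeneous_ideal X I \<longleftrightarrow>
     (\<forall>A. A \<subseteq> X \<and> A \<notin> I \<longrightarrow> isomorphic_ideals A (restrict_ideal I A) X I)"

definition katetov_homogeneous_ideal :: "'a set \<Rightarrow> 'a set set \<Rightarrow> bool" where
  "katetov_homogeneous_ideal X I \<longleftrightarrow>
     (\<forall>A. A \<subseteq> X \<and> A \<notin> I \<longrightarrow>
        katetov_le A (restrict_ideal I A) X I \<and> katetov_le X I A (restrict_ideal I A))"

text \<open>The limit only makes sense for infinite sets, as \<^const>\<open>enumerate\<close> is the increasing
  enumeration only of those; finite sets are added to the generators separately. The
  differences are positive, so the subtraction on \<^typ>\<open>nat\<close> does not truncate.\<close>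

definition lacunary :: "nat set \<Rightarrow> bool" where
  "lacunary A \<longleftrightarrow> infinite A \<and>
     filterlim (\<lambda>n. enumerate A (Suc n) - enumerate A n) at_top sequentially"

definition lacunary_ideal :: "nat set set" where
  "lacunary_ideal =
     {A. \<exists>F. finite F \<and> (\<forall>B\<in>F. lacunary B \<or> finite B) \<and> A \<subseteq> \<Union>F}"

lemma lacunary_or_finite_gaps:
  assumes "lacunary B \<or> finite B"
  shows "\<exists>N. \<forall>x\<in>B. \<forall>y\<in>B. N \<le> x \<longrightarrow> x < y \<longrightarrow> x + k < y"
proof (cases "finite B")
  case True
  then obtain N where "\<forall>x\<in>B. x < N"
    using finite_nat_set_iff_bounded by auto
  then show ?thesis
    by (meson not_le)
next
  case False
  with assms have inf: "infinite B"
    and lim: "filterlim (\<lambda>n. enumerate B (Suc n) - enumerate B n) at_top sequentially"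
    by (auto simp: lacunary_def)
  from lim have "eventually (\<lambda>n. Suc k \<le> enumerate B (Suc n) - enumerate B n) sequentially"
    by (simp add: filterlim_at_top)
  then obtain m where m: "\<And>n. m \<le> n \<Longrightarrow> Suc k \<le> enumerate B (Suc n) - enumerate B n"
    by (auto simp: eventually_sequentially)
  have "x + k < y" if xy: "x \<in> B" "y \<in> B" "enumerate B m \<le> x" "x < y" for x y
  proof -
    obtain i where i: "enumerate B i = x"
      using enumerate_Ex[OF inf xy(1)] by blast
    obtain j where j: "enumerate B j = y"
      using enumerate_Ex[OF inf xy(2)] by blast
    have "m \<le> i"
      using xy(3) inf unfolding i[symmetric] by simp
    then have "Suc k \<le> enumerate B (Suc i) - x"
      using m i by blast
    moreover have "i < j"
      using xy(4) inf unfolding i[symmetric] j[symmetric] by simp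
    then have "enumerate B (Suc i) \<le> y"
      using inf unfolding j[symmetric] by (simp add: Suc_le_eq)
    ultimately show ?thesis by linarith
  qed
  then show ?thesis by blast
qed

lemma ideal_on_lacunary_ideal: "ideal_on UNIV lacunary_ideal"
proof -
  have un: "A \<union> B \<in> lacunary_ideal" if AB: "A \<in> lacunary_ideal" "B \<in> lacunary_ideal" for A B
  proof -
    obtain F where F: "finite F" "\<forall>B\<in>F. lacunary B \<or> finite B" "A \<subseteq> \<Union>F"
      using AB(1) unfolding lacunary_ideal_def by blast
    obtain G where G: "finite G" "\<forall>B\<in>G. lacunary B \<or> finite B" "B \<subseteq> \<Union>G"
      using AB(2) unfolding lacunary_ideal_def by blast
    have "finite (F \<union> G) \<and> (\<forall>B\<in>F \<union> G. lacunary B \<or> finite B) \<and> A \<union> B \<subseteq> \<Union>(F \<union> G)"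
      using F G by blast
    then show ?thesis
      unfolding lacunary_ideal_def by blast
  qed
  have fin: "A \<in> lacunary_ideal" if "finite A" for A
    unfolding lacunary_ideal_def using that by (intro CollectI exI[of _ "{A}"]) auto
  have "UNIV \<notin> lacunary_ideal"
  proof
    assume "UNIV \<in> lacunary_ideal"
    then obtain F where F: "finite F" "\<forall>B\<in>F. lacunary B \<or> finite B" "\<Union>F = UNIV"
      unfolding lacunary_ideal_def by auto
    define k where "k = card F"
    have "\<forall>B\<in>F. \<exists>N. \<forall>x\<in>B. \<forall>y\<in>B. N \<le> x \<longrightarrow> x < y \<longrightarrow> x + k < y"
      using F(2) lacunary_or_finite_gaps by blast
    then obtain N where N: "\<forall>B\<in>F. \<forall>x\<in>B. \<forall>y\<in>B. N B \<le> x \<longrightarrow> x < y \<longrightarrow> x + k < y"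
      by metis
    define M where "M = (\<Sum>B\<in>F. N B)"
    have NM: "N B \<le> M" if "B \<in> F" for B
      unfolding M_def using that F(1) by (simp add: member_le_sum)
    have "\<forall>x. \<exists>B. B \<in> F \<and> x \<in> B"
      using F(3) by blast
    then obtain g where g: "\<And>x. g x \<in> F \<and> x \<in> g x"
      by metis
    have "card (g ` {M..M+k}) \<le> k"
      unfolding k_def using g by (intro card_mono F(1)) auto
    then have "\<not> inj_on g {M..M+k}"
      using card_image[of g "{M..M+k}"] by auto
    then obtain x y where xy: "x \<in> {M..M+k}" "y \<in> {M..M+k}" "x < y" "g x = g y"
      unfolding inj_on_def by (metis nat_neq_iff)
    have "g x \<in> F" "x \<in> g x" "y \<in> g x"
      using g[of x] g[of y] xy(4) by auto
    moreover from this have "N (g x) \<le> x"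
      using NM[of "g x"] xy(1) by simp
    ultimately have "x + k < y"
      using N xy(3) by blast
    then show False
      using xy(1,2) by simp
  qed
  moreover have down: "B \<in> lacunary_ideal" if "A \<in> lacunary_ideal" "B \<subseteq> A" for A B
  proof -
    from that(1) have "\<exists>F. finite F \<and> (\<forall>B\<in>F. lacunary B \<or> finite B) \<and> A \<subseteq> \<Union>F"
      by (simp add: lacunary_ideal_def)
    with that(2) have "\<exists>F. finite F \<and> (\<forall>B\<in>F. lacunary B \<or> finite B) \<and> B \<subseteq> \<Union>F"
      by (meson subset_trans)
    then show ?thesis
      by (simp add: lacunary_ideal_def)
  qed
  ultimately show ?thesis
    unfolding ideal_on_def Pow_UNIV
    by (intro conjI ballI allI impI subset_UNIV) (auto intro: un fin down)
qed

end

theory Submission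
  imports Defs "HOL-Library.Nat_Bijection"
begin

text \<open>Write \<open>L\<close> for the lacunary ideal. Let \<open>A\<close> be the union of countably many sets
  \<open>A\<^sub>k \<in> L\<close>, and suppose that every \<open>D \<subseteq> A\<close> that meets each \<open>A\<^sub>k\<close> in a finite set is in \<open>L\<close>. Then
  \<open>L\<restriction>A\<close> is not Katetov below \<open>L\<close>. Indeed, suppose that \<open>f\<close> maps the natural numbers into \<open>A\<close> and
  pulls sets of \<open>L\<close> back to sets of \<open>L\<close>. A set in \<open>L\<close> has, for some \<open>k\<close>, at most \<open>k\<close> points in every
  window of any fixed length that is far enough out (\<open>lacunary_ideal_window\<close>), so it misses
  arbitrarily long intervals arbitrarily far out (\<open>lacunary_ideal_missed_interval\<close>). Hence there are
  intervals \<open>R\<^sub>m\<close> of length \<open>m\<close>, tending to infinity, with \<open>f[R\<^sub>m]\<close> disjoint from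
  \<open>A\<^sub>0 \<union> \<dots> \<union> A\<^sub>m\<close>. The image \<open>D\<close> of \<open>\<Union>\<^sub>m R\<^sub>m\<close> meets each \<open>A\<^sub>k\<close> in a finite set, so
  \<open>D \<in> L\<close>, but the preimage of \<open>D\<close> contains every \<open>R\<^sub>m\<close> and is therefore not in \<open>L\<close>
  (\<open>not_katetov_le_restrict_lacunary\<close>). It remains to find such an \<open>A\<close> that is not in \<open>L\<close>.

  A union of clusters will do, the \<open>n\<close>-th of which starts at \<open>n\<^sup>3\<close> and is an arithmetic
  progression with \<open>k\<close> terms and difference \<open>k\<close>, where \<open>k \<le> n\<close> depends on \<open>n\<close> and takes every value
  infinitely often; \<open>A\<^sub>k\<close> is the union of the clusters with parameter \<open>k\<close>. The gaps between
  clusters tend to infinity, so \<open>A\<^sub>k\<close> is a union of \<open>k\<close> sets in \<open>L\<close>, whereas for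
  every \<open>k\<close> there are windows of length \<open>k\<^sup>2\<close> arbitrarily far out with \<open>k\<close> points of \<open>A\<close>. If \<open>D\<close> meets each \<open>A\<^sub>k\<close> in a finite
  set then the gaps inside the clusters also tend to infinity along \<open>D\<close>, and \<open>D\<close> is lacunary or
  finite.\<close>

section \<open>Sets in the lacunary ideal\<close>

lemma lacunary_or_finiteI:
  assumes gaps: "\<And>g. \<exists>N. \<forall>x\<in>B. \<forall>y\<in>B. N \<le> x \<longrightarrow> x < y \<longrightarrow> x + g < y"
  shows "lacunary B \<or> finite B"
proof (cases "finite B")
  case False
  have "eventually (\<lambda>n. g \<le> enumerate B (Suc n) - enumerate B n) sequentially" for g
  proof -
    obtain N where N: "\<forall>x\<in>B. \<forall>y\<in>B. N \<le> x \<longrightarrow> x < y \<longrightarrow> x + g < y"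
      using gaps by blast
    have "g \<le> enumerate B (Suc n) - enumerate B n" if "N \<le> n" for n
    proof -
      have "N \<le> enumerate B n"
        using that le_enumerate[OF False, of n] by linarith
      moreover have "enumerate B n < enumerate B (Suc n)"
        using False by simp
      ultimately have "enumerate B n + g < enumerate B (Suc n)"
        using N enumerate_in_set[OF False] by blast
      then show ?thesis by linarith
    qed
    then show ?thesis
      by (auto simp: eventually_sequentially)
  qed
  then show ?thesis
    using False by (simp add: lacunary_def filterlim_at_top)
qed simp

lemma lacunary_or_finite_in_ideal:
  assumes "lacunary B \<or> finite B"
  shows "B \<in> lacunary_ideal"
  unfolding lacunary_ideal_def using assms by (intro CollectI exI[of _ "{B}"]) auto

lemma lacunary_ideal_UN:
  assumes "finite I" "\<And>i. i \<in> I \<Longrightarrow> B i \<in> lacunary_ideal"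
  shows "(\<Union>i\<in>I. B i) \<in> lacunary_ideal"
  using assms
proof (induction I rule: finite_induct)
  case empty
  then show ?case
    by (simp add: lacunary_or_finite_in_ideal)
next
  case (insert i I)
  then show ?case
    using ideal_on_lacunary_ideal by (auto simp: ideal_on_def)
qed

text \<open>The bound \<open>k\<close> is the number of generators covering \<open>S\<close>, each of which has at most one point
  in a window of length \<open>m\<close> far enough out; it does not depend on \<open>m\<close>.\<close>

lemma lacunary_ideal_window:
  assumes "S \<in> lacunary_ideal"
  obtains k where "\<And>m. \<exists>N. \<forall>x\<ge>N. card (S \<inter> {x..<x + m}) \<le> k"
proof -
  obtain F where F: "finite F" "\<forall>B\<in>F. lacunary B \<or> finite B" "S \<subseteq> \<Union>F"
    using assms unfolding lacunary_ideal_def by blast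
  have "\<exists>N. \<forall>x\<ge>N. card (S \<inter> {x..<x + m}) \<le> card F" for m
  proof -
    have "\<forall>B\<in>F. \<exists>N. \<forall>x\<in>B. \<forall>y\<in>B. N \<le> x \<longrightarrow> x < y \<longrightarrow> x + m < y"
      using F(2) lacunary_or_finite_gaps by blast
    then obtain N where N: "\<forall>B\<in>F. \<forall>x\<in>B. \<forall>y\<in>B. N B \<le> x \<longrightarrow> x < y \<longrightarrow> x + m < y"
      by metis
    have "card (S \<inter> {x..<x + m}) \<le> card F" if x: "(\<Sum>B\<in>F. N B) \<le> x" for x
    proof -
      have one: "card (B \<inter> {x..<x + m}) \<le> 1" if B: "B \<in> F" for B
      proof -
        have Nx: "N B \<le> x"
          using member_le_sum[of B F N] B F(1) x by simp
        have "\<not> u < v" if "u \<in> B \<inter> {x..<x + m}" "v \<in> B \<inter> {x..<x + m}" for u v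
        proof
          assume "u < v"
          then have "u + m < v"
            using N B Nx that by (metis IntE atLeastLessThan_iff order_trans)
          then show False
            using that by simp
        qed
        then have "u = v" if "u \<in> B \<inter> {x..<x + m}" "v \<in> B \<inter> {x..<x + m}" for u v
          using that by (metis nat_neq_iff)
        then show ?thesis
          by (simp add: card_le_Suc0_iff_eq)
      qed
      have "card (S \<inter> {x..<x + m}) \<le> card (\<Union>B\<in>F. B \<inter> {x..<x + m})"
        using F(1,3) by (intro card_mono) auto
      also have "\<dots> \<le> (\<Sum>B\<in>F. card (B \<inter> {x..<x + m}))"
        using F(1) by (rule card_UN_le)
      also have "\<dots> \<le> (\<Sum>B\<in>F. 1)"
        using one by (intro sum_mono) auto
      finally show ?thesis by simp
    qed
    then show ?thesis by blast
  qed
  then show ?thesis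
    using that by blast
qed

lemma lacunary_ideal_missed_interval:
  assumes "S \<in> lacunary_ideal"
  shows "\<exists>r\<ge>M. S \<inter> {r..<r + m} = {}"
proof (rule ccontr)
  assume hit: "\<not> ?thesis"
  obtain k where k: "\<And>m. \<exists>N. \<forall>x\<ge>N. card (S \<inter> {x..<x + m}) \<le> k"
    using lacunary_ideal_window[OF assms] by blast
  \<comment> \<open>A window made of \<open>Suc k\<close> adjacent intervals of length \<open>m\<close>, each of which meets \<open>S\<close>, has
    too many points of \<open>S\<close>.\<close>
  obtain N where N: "\<forall>x\<ge>N. card (S \<inter> {x..<x + Suc k * m}) \<le> k"
    using k by blast
  define x where "x = max M N"
  have "\<exists>s. s \<in> S \<inter> {x + i * m..<x + i * m + m}" for i
  proof -
    have "M \<le> x + i * m"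
      by (simp add: x_def)
    then show ?thesis
      using hit by blast
  qed
  then obtain s where s: "\<And>i. s i \<in> S \<inter> {x + i * m..<x + i * m + m}"
    by metis
  have "strict_mono s"
  proof (unfold strict_mono_Suc_iff, rule allI)
    fix i
    show "s i < s (Suc i)"
      using s[of i] s[of "Suc i"] by simp
  qed
  then have inj: "inj_on s {..k}"
    by (metis inj_on_subset strict_mono_imp_inj_on subset_UNIV)
  have "s ` {..k} \<subseteq> S \<inter> {x..<x + Suc k * m}"
  proof
    fix y assume "y \<in> s ` {..k}"
    then obtain i where i: "i \<le> k" "y = s i" by blast
    have "s i \<in> S" "x + i * m \<le> s i" "s i < x + i * m + m"
      using s[of i] by auto
    moreover have "i * m + m \<le> Suc k * m"
      using mult_le_mono1[of "Suc i" "Suc k" m] i by simp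
    ultimately have "s i \<in> S" "x \<le> s i" "s i < x + Suc k * m"
      by linarith+
    then show "y \<in> S \<inter> {x..<x + Suc k * m}"
      using i by simp
  qed
  then have "card (s ` {..k}) \<le> card (S \<inter> {x..<x + Suc k * m})"
    by (intro card_mono) auto
  also have "\<dots> \<le> k"
    using N by (simp add: x_def)
  finally show False
    using card_image[OF inj] by simp
qed

section \<open>Restrictions that are not Katetov below the lacunary ideal\<close>

text \<open>The sets \<open>P k\<close> need not be disjoint, and it is \<open>selector\<close> alone that ties them to \<open>A\<close>.\<close>

lemma not_katetov_le_restrict_lacunary:
  fixes P :: "nat \<Rightarrow> nat set"
  assumes part: "\<And>k. P k \<in> lacunary_ideal"
    and selector: "\<And>D. D \<subseteq> A \<Longrightarrow> (\<And>k. finite (D \<inter> P k)) \<Longrightarrow> D \<in> lacunary_ideal"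
  shows "\<not> katetov_le A (restrict_ideal lacunary_ideal A) (UNIV :: nat set) lacunary_ideal"
proof
  assume "katetov_le A (restrict_ideal lacunary_ideal A) (UNIV :: nat set) lacunary_ideal"
  then obtain f :: "nat \<Rightarrow> nat" where fA: "\<And>x. f x \<in> A"
    and f: "\<And>B. B \<in> restrict_ideal lacunary_ideal A \<Longrightarrow> f -` B \<in> lacunary_ideal"
    unfolding katetov_le_def by auto
  have pull: "f -` B \<in> lacunary_ideal" if "B \<in> lacunary_ideal" for B
  proof -
    have "f -` (B \<inter> A) \<in> lacunary_ideal"
      using f that unfolding restrict_ideal_def by blast
    moreover have "f -` (B \<inter> A) = f -` B"
      using fA by auto
    ultimately show ?thesis by simp
  qed
  have "\<exists>r\<ge>m. f -` (\<Union>k\<in>{..m}. P k) \<inter> {r..<r + m} = {}" for m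
    by (intro lacunary_ideal_missed_interval pull lacunary_ideal_UN part) simp_all
  then obtain r where r: "\<And>m. m \<le> r m"
    and miss: "\<And>m. f -` (\<Union>k\<in>{..m}. P k) \<inter> {r m..<r m + m} = {}"
    by metis
  define D where "D = f ` (\<Union>m. {r m..<r m + m})"
  have "finite (D \<inter> P k)" for k
  proof (rule finite_subset)
    show "D \<inter> P k \<subseteq> f ` (\<Union>m\<in>{..<k}. {r m..<r m + m})"
    proof
      fix y assume y: "y \<in> D \<inter> P k"
      then obtain m x where x: "x \<in> {r m..<r m + m}" "y = f x"
        unfolding D_def by blast
      have "\<not> k \<le> m"
        using miss[of m] x y by blast
      then show "y \<in> f ` (\<Union>m\<in>{..<k}. {r m..<r m + m})"
        using x by force
    qed
  qed simp
  then have "D \<in> lacunary_ideal"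
    using selector fA unfolding D_def by blast
  then have "f -` D \<in> lacunary_ideal"
    by (rule pull)
  then obtain k where k: "\<And>m. \<exists>N. \<forall>x\<ge>N. card (f -` D \<inter> {x..<x + m}) \<le> k"
    using lacunary_ideal_window by blast
  then obtain N where N: "\<forall>x\<ge>N. card (f -` D \<inter> {x..<x + Suc k}) \<le> k"
    by blast
  \<comment> \<open>The interval \<open>R\<^sub>m\<close> is then long enough and, as \<open>m \<le> r m\<close>, far enough out.\<close>
  define m where "m = max N (Suc k)"
  have "{r m..<r m + Suc k} \<subseteq> {r m..<r m + m}"
    by (auto simp: m_def)
  then have "f -` D \<inter> {r m..<r m + Suc k} = {r m..<r m + Suc k}"
    unfolding D_def by blast
  moreover have "N \<le> r m"
    using r[of m] by (simp add: m_def)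
  ultimately show False
    using N by fastforce
qed

section \<open>The clusters\<close>

text \<open>The number of terms, and the difference, of the \<open>n\<close>-th cluster: the first component under a
  pairing bijection, so that it is at most \<open>n\<close> and takes every value infinitely often.\<close>

definition cluster_param :: "nat \<Rightarrow> nat" where
  "cluster_param n = fst (prod_decode n)"

text \<open>The union of all clusters with parameter \<open>k\<close>. It is empty for \<open>k = 0\<close>.\<close>

definition cluster_part :: "nat \<Rightarrow> nat set" where
  "cluster_part k = {n ^ 3 + i * k | n i. cluster_param n = k \<and> i < k}"

lemma cluster_param_le: "cluster_param n \<le> n"
  using le_prod_encode_1[of "fst (prod_decode n)" "snd (prod_decode n)"]
  by (simp add: cluster_param_def)

lemma cluster_param_frequently: "\<exists>n\<ge>M. cluster_param n = k"
  using le_prod_encode_2[of M k]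
  by (intro exI[of _ "prod_encode (k, M)"]) (simp add: cluster_param_def)

lemma cluster_offset_le:
  assumes "i < cluster_param n"
  shows "i * cluster_param n \<le> n ^ 2"
proof -
  have "i \<le> n" "cluster_param n \<le> n"
    using assms cluster_param_le[of n] by auto
  then show ?thesis
    unfolding power2_eq_square by (rule mult_le_mono)
qed

text \<open>The \<open>n\<close>-th cluster lies in \<open>{n\<^sup>3..n\<^sup>3 + n\<^sup>2}\<close>, and \<open>(n + 1)\<^sup>3 > n\<^sup>3 + n\<^sup>2 + n\<close>. The
  assumption \<open>far\<close> forces \<open>g \<le> n\<close>.\<close>

lemma distinct_clusters_gap:
  fixes n n' s s' g :: nat
  assumes "s \<le> n ^ 2" "s' \<le> n' ^ 2" "n \<noteq> n'"
    and less: "n ^ 3 + s < n' ^ 3 + s'"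
    and far: "Suc g ^ 3 \<le> n ^ 3 + s"
  shows "n ^ 3 + s + g < n' ^ 3 + s'"
proof -
  have cube: "j ^ 3 + j ^ 2 + j < Suc j ^ 3" for j :: nat
    by (simp add: power3_eq_cube power2_eq_square algebra_simps)
  have next_cluster: "i ^ 3 + t + i < j ^ 3" if "i < j" "t \<le> i ^ 2" for i j t :: nat
  proof -
    have "i ^ 3 + t + i < Suc i ^ 3"
      using cube[of i] that(2) by linarith
    also have "\<dots> \<le> j ^ 3"
      using that(1) by (intro power_mono) auto
    finally show ?thesis .
  qed
  have "n < n'"
  proof (rule ccontr)
    assume "\<not> n < n'"
    then have "n' ^ 3 + s' + n' < n ^ 3"
      using assms by (intro next_cluster) auto
    then show False
      using less by linarith
  qed
  then have "n ^ 3 + s + n < n' ^ 3"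
    using assms by (intro next_cluster) auto
  moreover have "g \<le> n"
  proof (rule ccontr)
    assume "\<not> g \<le> n"
    then have "n ^ 3 + s + n < Suc g ^ 3"
      using assms by (intro next_cluster) auto
    then show False
      using far by linarith
  qed
  ultimately show ?thesis by linarith
qed

lemma cluster_part_in_lacunary_ideal: "cluster_part k \<in> lacunary_ideal"
proof -
  define B where "B i = {n ^ 3 + i * k | n. cluster_param n = k}" for i
  have "B i \<in> lacunary_ideal" if i: "i < k" for i
  proof (intro lacunary_or_finite_in_ideal lacunary_or_finiteI exI ballI impI)
    fix g x y
    assume xy: "x \<in> B i" "y \<in> B i" "Suc g ^ 3 \<le> x" "x < y"
    obtain n where n: "x = n ^ 3 + i * k" "cluster_param n = k"
      using xy unfolding B_def by blast
    obtain n' where n': "y = n' ^ 3 + i * k" "cluster_param n' = k"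
      using xy unfolding B_def by blast
    have "i * k \<le> n ^ 2" "i * k \<le> n' ^ 2"
      using cluster_offset_le[of i n] cluster_offset_le[of i n'] n n' i by auto
    moreover have "n \<noteq> n'"
      using xy(4) n n' by auto
    ultimately show "x + g < y"
      unfolding n(1) n'(1)
      by (rule distinct_clusters_gap) (use n(1) n'(1) xy(3,4) in auto)
  qed
  then have "(\<Union>i\<in>{..<k}. B i) \<in> lacunary_ideal"
    by (intro lacunary_ideal_UN) auto
  moreover have "cluster_part k = (\<Union>i\<in>{..<k}. B i)"
    unfolding cluster_part_def B_def by blast
  ultimately show ?thesis by simp
qed

lemma UN_cluster_part_notin_lacunary_ideal: "(\<Union>k. cluster_part k) \<notin> lacunary_ideal"
proof
  assume "(\<Union>k. cluster_part k) \<in> lacunary_ideal"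
  then obtain k where k: "\<And>m. \<exists>N. \<forall>x\<ge>N. card ((\<Union>k. cluster_part k) \<inter> {x..<x + m}) \<le> k"
    using lacunary_ideal_window by blast
  define q where "q = Suc k"
  obtain N where N: "\<forall>x\<ge>N. card ((\<Union>k. cluster_part k) \<inter> {x..<x + q * q}) \<le> k"
    using k by blast
  obtain n where n: "N \<le> n" "cluster_param n = q"
    using cluster_param_frequently by blast
  have "n ^ 3 + i * q \<in> (\<Union>k. cluster_part k) \<inter> {n ^ 3..<n ^ 3 + q * q}" if "i < q" for i
  proof -
    have "n ^ 3 + i * q \<in> cluster_part q"
      using n(2) that unfolding cluster_part_def by blast
    moreover have "i * q < q * q"
      using that by (intro mult_less_mono1) auto
    ultimately show ?thesis by auto
  qed
  then have "(\<lambda>i. n ^ 3 + i * q) ` {..<q}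
      \<subseteq> (\<Union>k. cluster_part k) \<inter> {n ^ 3..<n ^ 3 + q * q}"
    by blast
  then have "card ((\<lambda>i. n ^ 3 + i * q) ` {..<q})
      \<le> card ((\<Union>k. cluster_part k) \<inter> {n ^ 3..<n ^ 3 + q * q})"
    by (intro card_mono) auto
  also have "\<dots> \<le> k"
  proof -
    have "n \<le> n ^ 3"
      using self_le_power[of n 3] by (cases "n = 0") simp_all
    then show ?thesis
      using N n(1) by simp
  qed
  also have "card ((\<lambda>i. n ^ 3 + i * q) ` {..<q}) = q"
  proof -
    have "q > 0"
      by (simp add: q_def)
    then show ?thesis
      by (subst card_image) (auto simp: inj_on_def)
  qed
  finally show False
    by (simp add: q_def)
qed

lemma cluster_selector_in_lacunary_ideal:
  assumes D: "D \<subseteq> (\<Union>k. cluster_part k)" and fin: "\<And>k. finite (D \<inter> cluster_part k)"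
  shows "D \<in> lacunary_ideal"
proof (intro lacunary_or_finite_in_ideal lacunary_or_finiteI)
  fix g
  have "finite (\<Union>k\<in>{..g}. D \<inter> cluster_part k)"
    by (intro finite_UN_I fin finite_atMost)
  then obtain M where "\<forall>x\<in>(\<Union>k\<in>{..g}. D \<inter> cluster_part k). x < M"
    unfolding finite_nat_set_iff_bounded ..
  then have M: "x < M" if "k \<le> g" "x \<in> D" "x \<in> cluster_part k" for x k
    using that by blast
  have "x + g < y" if xy: "x \<in> D" "y \<in> D" "max M (Suc g ^ 3) \<le> x" "x < y" for x y
  proof -
    obtain n i where n: "x = n ^ 3 + i * cluster_param n" "i < cluster_param n"
      using xy(1) D unfolding cluster_part_def by blast
    obtain n' i' where n': "y = n' ^ 3 + i' * cluster_param n'" "i' < cluster_param n'"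
      using xy(2) D unfolding cluster_part_def by blast
    show ?thesis
    proof (cases "n = n'")
      case True
      have "x \<in> cluster_part (cluster_param n)"
        using n unfolding cluster_part_def by blast
      moreover have "\<not> x < M"
        using xy(3) by simp
      ultimately have "g < cluster_param n"
        using M xy(1) not_le by metis
      moreover have "i < i'"
        using xy(4) n n' True by simp
      then have "i * cluster_param n + cluster_param n \<le> i' * cluster_param n"
        using mult_le_mono1[of "Suc i" i' "cluster_param n"] by simp
      ultimately show ?thesis
        unfolding n(1) n'(1) True[symmetric] by linarith
    next
      case False
      have "i * cluster_param n \<le> n ^ 2" "i' * cluster_param n' \<le> n' ^ 2"
        using n(2) n'(2) by (simp_all add: cluster_offset_le)
      then show ?thesis
        unfolding n(1) n'(1) using False
        by (rule distinct_clusters_gap) (use n(1) n'(1) xy(3,4) in auto)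
    qed
  qed
  then show "\<exists>N. \<forall>x\<in>D. \<forall>y\<in>D. N \<le> x \<longrightarrow> x < y \<longrightarrow> x + g < y"
    by blast
qed

section \<open>Failure of homogeneity\<close>

lemma isomorphic_ideals_imp_katetov_le:
  assumes "isomorphic_ideals X I Y K" "I \<subseteq> Pow X"
  shows "katetov_le X I Y K"
proof -
  obtain f where f: "bij_betw f Y X" "\<And>B. B \<subseteq> X \<Longrightarrow> f -` B \<inter> Y \<in> K \<longleftrightarrow> B \<in> I"
    using assms(1) unfolding isomorphic_ideals_def by blast
  then have "\<forall>B\<in>I. f -` B \<inter> Y \<in> K"
    using assms(2) by auto
  then show ?thesis
    unfolding katetov_le_def using bij_betw_imp_funcset[OF f(1)] by blast
qed

theorem proposition10p3:
  shows "\<not> katetov_homogeneous_ideal (UNIV :: nat set) lacunary_ideal \<and>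
         \<not> homogeneous_ideal (UNIV :: nat set) lacunary_ideal"
proof -
  define A where "A = (\<Union>k. cluster_part k)"
  have not_le: "\<not> katetov_le A (restrict_ideal lacunary_ideal A) (UNIV :: nat set) lacunary_ideal"
  proof (rule not_katetov_le_restrict_lacunary)
    show "cluster_part k \<in> lacunary_ideal" for k
      by (rule cluster_part_in_lacunary_ideal)
    show "D \<in> lacunary_ideal" if "D \<subseteq> A" "\<And>k. finite (D \<inter> cluster_part k)" for D
      using that unfolding A_def by (rule cluster_selector_in_lacunary_ideal)
  qed
  have "restrict_ideal lacunary_ideal A \<subseteq> Pow A"
    unfolding restrict_ideal_def by blast
  then have "\<not> isomorphic_ideals A (restrict_ideal lacunary_ideal A) (UNIV :: nat set) lacunary_ideal"
    using not_le isomorphic_ideals_imp_katetov_le by blast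
  moreover have "A \<notin> lacunary_ideal"
    unfolding A_def by (rule UN_cluster_part_notin_lacunary_ideal)
  ultimately show ?thesis
    using not_le unfolding katetov_homogeneous_ideal_def homogeneous_ideal_def
    by (metis subset_UNIV)
qed

end
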